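(* Let $c>0$, and consider the two-vortex Hamiltonian system on the phase space $\mathcal P$ with Hamiltonian $H$, additional first integral $F$ and momentum map $\mathcal F=(F,H):\mathcal P\to\mathbb R^2$, as given in the context. Let $\Sigma=\mathcal F(\mathcal C)\subset\mathbb R^2(f,h)$ be its bifurcation diagram. Then $\Sigma=\gamma_1\cup\gamma_2$, where $$\gamma_1:\quad h=\ln\Bigl(1-\frac f2\Bigr)-\frac c2\ln(2f),\qquad 0<f<2,$$ and $\gamma_2$ is the parametrized curve $$\gamma_2:\quad\begin{cases} h=\dfrac12\ln\left[\dfrac{s^2(s-1)}{c+s-1}\right]-\dfrac c2\ln\left[\dfrac{c s^2}{c+s-1}\right],\\[3mm] f=\dfrac{c s^2-2(s-1)(c+s-1)}{c+s-1},\end{cases}\qquad s\in\left(1,\ \frac{2(1+\sqrt c)}{2+\sqrt c}\right].$$ Moreover, for $c>3$ the curve $\gamma_2$ has a cusp at $$s=\frac{\bigl[2-c+\sqrt{c(c-2)}\bigr](c-1)}{c-2},$$ and for $c=3$ this value of $s$ coincides with $s=\frac{2(1+\sqrt c)}{2+\sqrt c}$, the parameter value of the point of tangency of $\gamma_2$ with $\gamma_1$.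
   Context: The system describes two vortices of identical intensities $\Gamma_1=\Gamma_2=1$ in a Bose–Einstein condensate in a harmonic trap, with positive parameter $c$. The phase space is $$\mathcal P=\{(x_1,y_1,x_2,y_2)\in\mathbb R^4: x_1^2+y_1^2<1,\ x_2^2+y_2^2<1\}\setminus\{x_1=x_2,\ y_1=y_2\}.$$ The equations of motion are $x_k'=\partial H/\partial y_k$, $y_k'=-\partial H/\partial x_k$, $k=1,2$, with Hamiltonian $$H=\tfrac12\ln\bigl[1-(x_1^2+y_1^2)\bigr]+\tfrac12\ln\bigl[1-(x_2^2+y_2^2)\bigr]-\tfrac c2\ln\bigl[(x_2-x_1)^2+(y_2-y_1)^2\bigr].$$ The additional first integral (moment of vorticity) is $F=x_1^2+y_1^2+x_2^2+y_2^2$. The momentum map is $\mathcal F:\mathcal P\to\mathbb R^2$, $\mathcal F(\zeta)=(F(\zeta),H(\zeta))=(f,h)$. The set of critical points is $\mathcal C=\{\zeta\in\mathcal P:\operatorname{rank}d\mathcal F(\zeta)<2\}$, and the bifurcation diagram is the set of critical values $\Sigma=\mathcal F(\mathcal C)$. A cusp of a smooth parametrized plane curve $s\mapsto(f(s),h(s))$ is understood in the usual sense: an interior parameter value at which $(f',h')=(0,0)$ while the vectors $(f'',h'')$ and $(f''',h''')$ are linearly independent. *)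

theory Defs
  imports "HOL-Analysis.Analysis"
begin

definition phase_space :: "(real \<times> real \<times> real \<times> real) set" where
  "phase_space =
     {(x1, y1, x2, y2). x1\<^sup>2 + y1\<^sup>2 < 1 \<and> x2\<^sup>2 + y2\<^sup>2 < 1}
     - {(x1, y1, x2, y2). x1 = x2 \<and> y1 = y2}"

definition hamiltonian :: "real \<Rightarrow> real \<times> real \<times> real \<times> real \<Rightarrow> real" where
  "hamiltonian c = (\<lambda>(x1, y1, x2, y2).
     1/2 * ln (1 - (x1\<^sup>2 + y1\<^sup>2)) + 1/2 * ln (1 - (x2\<^sup>2 + y2\<^sup>2))
     - c/2 * ln ((x2 - x1)\<^sup>2 + (y2 - y1)\<^sup>2))"

definition moment_of_vorticity :: "real \<times> real \<times> real \<times> real \<Rightarrow> real" where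
  "moment_of_vorticity = (\<lambda>(x1, y1, x2, y2). x1\<^sup>2 + y1\<^sup>2 + x2\<^sup>2 + y2\<^sup>2)"

definition momentum_map :: "real \<Rightarrow> real \<times> real \<times> real \<times> real \<Rightarrow> real \<times> real" where
  "momentum_map c \<zeta> = (moment_of_vorticity \<zeta>, hamiltonian c \<zeta>)"

(* The momentum map is smooth on the open set phase_space, so the Frechet derivative
   below is the actual differential; its rank is the dimension of its range. *)
definition critical_points :: "real \<Rightarrow> (real \<times> real \<times> real \<times> real) set" where
  "critical_points c =
     {\<zeta> \<in> phase_space. dim (range (frechet_derivative (momentum_map c) (at \<zeta>))) < 2}"

definition bifurcation_diagram :: "real \<Rightarrow> (real \<times> real) set" where
  "bifurcation_diagram c = momentum_map c ` critical_points c"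

definition gamma1 :: "real \<Rightarrow> real \<Rightarrow> real \<times> real" where
  "gamma1 c f = (f, ln (1 - f/2) - c/2 * ln (2 * f))"

definition gamma2 :: "real \<Rightarrow> real \<Rightarrow> real \<times> real" where
  "gamma2 c s =
     ((c * s\<^sup>2 - 2 * (s - 1) * (c + s - 1)) / (c + s - 1),
      1/2 * ln (s\<^sup>2 * (s - 1) / (c + s - 1)) - c/2 * ln (c * s\<^sup>2 / (c + s - 1)))"

definition s_tangency :: "real \<Rightarrow> real" where
  "s_tangency c = 2 * (1 + sqrt c) / (2 + sqrt c)"

definition s_cusp :: "real \<Rightarrow> real" where
  "s_cusp c = (2 - c + sqrt (c * (c - 2))) * (c - 1) / (c - 2)"

definition gamma1_domain :: "real set" where
  "gamma1_domain = {0<..<2}"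

definition gamma2_domain :: "real \<Rightarrow> real set" where
  "gamma2_domain c = {1<..s_tangency c}"

definition nth_vector_derivative ::
    "nat \<Rightarrow> (real \<Rightarrow> 'a::real_normed_vector) \<Rightarrow> real \<Rightarrow> 'a" where
  "nth_vector_derivative n g = ((\<lambda>g t. vector_derivative g (at t)) ^^ n) g"

definition smooth_curve_on :: "(real \<Rightarrow> 'a::real_normed_vector) \<Rightarrow> real set \<Rightarrow> bool" where
  "smooth_curve_on g S \<longleftrightarrow> (\<forall>n. \<forall>t\<in>S. nth_vector_derivative n g differentiable (at t))"

(* The inequality is needed since {v, w} collapses to a singleton when v = w. *)
definition has_cusp_at :: "(real \<Rightarrow> real \<times> real) \<Rightarrow> real set \<Rightarrow> real \<Rightarrow> bool" where
  "has_cusp_at g S t \<longleftrightarrow>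
     smooth_curve_on g (interior S) \<and> t \<in> interior S \<and>
     nth_vector_derivative 1 g t = 0 \<and>
     nth_vector_derivative 2 g t \<noteq> nth_vector_derivative 3 g t \<and>
     independent {nth_vector_derivative 2 g t, nth_vector_derivative 3 g t}"

(* The line g t + span {v} is the tangent line of the curve g (with parameter set S) at t:
   the distance of g u from it is o(|g u - g t|) as u tends to t in S.  If g has a nonzero
   derivative at t this is the line spanned by that derivative; the definition by secants
   also covers an end point of S at which the derivative vanishes, as happens for gamma2
   at s_tangency c when c = 3. *)
definition has_tangent_direction ::
    "(real \<Rightarrow> real \<times> real) \<Rightarrow> real set \<Rightarrow> real \<Rightarrow> real \<times> real \<Rightarrow> bool" where
  "has_tangent_direction g S t v \<longleftrightarrow>
     v \<noteq> 0 \<and> t \<in> S \<and> t islimpt S \<and>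
     (\<forall>\<^sub>F u in at t within S. g u \<noteq> g t) \<and>
     ((\<lambda>u. infdist (g u - g t) (span {v}) / norm (g u - g t)) \<longlongrightarrow> 0) (at t within S)"

definition tangent_curves_at ::
    "(real \<Rightarrow> real \<times> real) \<Rightarrow> real set \<Rightarrow> real \<Rightarrow>
     (real \<Rightarrow> real \<times> real) \<Rightarrow> real set \<Rightarrow> real \<Rightarrow> bool" where
  "tangent_curves_at g S t k T u \<longleftrightarrow>
     g t = k u \<and> (\<exists>v. has_tangent_direction g S t v \<and> has_tangent_direction k T u v)"

end

(* A critical point of (F,H) must have both vortices on one line through the centre. With squared
   distances r1, r2 of the vortices from the centre and q the inner product of their positions
   (so q^2 = r1 r2), eliminating the Lagrange multiplier leaves
   (r1 - r2) (q d + c (1 - r1) (1 - r2)) = 0, where d is the squared distance of the vortices. The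
   first factor gives gamma1, and the second one gives gamma2 with s = 1 - q; the condition
   r1 + r2 >= 2 sqrt (r1 r2) bounds s by s_tangency c.

   Along gamma2 one has h' = m f' with m = - (c + s - 1) / (2 s (s - 1)). Hence f' = 0 forces h' = 0,
   and there det ((f'', h''), (f''', h''')) = 2 m' f''^2, which does not vanish as m' > 0. Moreover
   m is the slope of gamma2 in the secant sense also where f' vanishes, and it equals the slope of
   gamma1 at the same f exactly when 4 p^2 = c (1 - p)^2 with p = s - 1, that is at s_tangency c. *)
theory Submission
  imports Defs
begin

section \<open>Critical points of the momentum map\<close>

text \<open>This turns the rank condition into a Lagrange equation dH = \<open>l\<close> dF. Where
  \<open>B\<close> deviates from the multiple of \<open>A\<close> fixed at \<open>v0\<close>, two
  independent values arise; conversely all values lie on the line through (1,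
  \<open>l\<close>).\<close>

lemma dim_range_prod_less_2_iff:
  fixes A B :: "'a \<Rightarrow> real"
  assumes A: "A v0 \<noteq> 0"
  shows "dim (range (\<lambda>v. (A v, B v))) < 2 \<longleftrightarrow> (\<exists>l. \<forall>v. B v = l * A v)"
proof
  assume lt: "dim (range (\<lambda>v. (A v, B v))) < 2"
  show "\<exists>l. \<forall>v. B v = l * A v"
  proof (rule ccontr)
    assume "\<not> ?thesis"
    then obtain v where v: "B v \<noteq> B v0 / A v0 * A v" by blast
    let ?a = "(A v0, B v0)" and ?b = "(A v, B v)"
    have "?b \<notin> span {?a}" using v A by (auto simp: span_singleton)
    moreover have "?a \<noteq> 0" using A by (simp add: zero_prod_def)
    ultimately have "independent {?b, ?a}" "?a \<noteq> ?b"
      by (auto simp: independent_insert span_base)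
    moreover have "{?b, ?a} \<subseteq> range (\<lambda>v. (A v, B v))" by auto
    ultimately show False using lt independent_card_le_dim[of "{?b, ?a}" "range (\<lambda>v. (A v, B v))"] by auto
  qed
next
  assume "\<exists>l. \<forall>v. B v = l * A v"
  then obtain l where l: "\<And>v. B v = l * A v" by blast
  have "(A v, B v) = A v *\<^sub>R (1, l)" for v by (simp add: l)
  then have "range (\<lambda>v. (A v, B v)) \<subseteq> span {(1, l)}"
    unfolding span_singleton by (metis (mono_tags, lifting) image_subsetI rangeI)
  then have "dim (range (\<lambda>v. (A v, B v))) \<le> card {(1::real, l)}" by (rule dim_le_card) simp
  then show "dim (range (\<lambda>v. (A v, B v))) < 2" by simp
qed

lemma momentum_map_has_derivative:
  fixes x1 y1 x2 y2 c :: real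
  assumes "(x1, y1, x2, y2) \<in> phase_space"
  defines "d \<equiv> (x2 - x1)\<^sup>2 + (y2 - y1)\<^sup>2"
  defines "u \<equiv> 1 - (x1\<^sup>2 + y1\<^sup>2)" and "w \<equiv> 1 - (x2\<^sup>2 + y2\<^sup>2)"
  shows "(momentum_map c has_derivative (\<lambda>v.
     (2 * x1 * fst v + 2 * y1 * fst (snd v) + 2 * x2 * fst (snd (snd v)) + 2 * y2 * snd (snd (snd v)),
      (c * (x2 - x1) / d - x1 / u) * fst v + (c * (y2 - y1) / d - y1 / u) * fst (snd v)
      - (c * (x2 - x1) / d + x2 / w) * fst (snd (snd v)) - (c * (y2 - y1) / d + y2 / w) * snd (snd (snd v)))))
    (at (x1, y1, x2, y2))"
proof -
  have "x2 - x1 \<noteq> 0 \<or> y2 - y1 \<noteq> 0" and uw: "u > 0" "w > 0"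
    using assms(1) by (auto simp: phase_space_def u_def w_def)
  then have d: "d > 0" by (auto simp: d_def sum_power2_gt_zero_iff)
  \<comment> \<open>Projections replace the tuple patterns so that the derivative rules
    apply.\<close>
  have mm: "momentum_map c = (\<lambda>z. ((fst z)\<^sup>2 + (fst (snd z))\<^sup>2 + (fst (snd (snd z)))\<^sup>2 + (snd (snd (snd z)))\<^sup>2,
     1/2 * ln (1 - ((fst z)\<^sup>2 + (fst (snd z))\<^sup>2)) + 1/2 * ln (1 - ((fst (snd (snd z)))\<^sup>2 + (snd (snd (snd z)))\<^sup>2))
     - c/2 * ln ((fst (snd (snd z)) - fst z)\<^sup>2 + (snd (snd (snd z)) - fst (snd z))\<^sup>2)))"
    by (auto simp: fun_eq_iff momentum_map_def moment_of_vorticity_def hamiltonian_def)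
  show ?thesis unfolding mm
    apply (rule derivative_eq_intros refl | (use d uw in \<open>simp add: d_def u_def w_def; fail\<close>))+
    using d uw
    apply (simp_all flip: d_def u_def w_def)
    apply (simp add: fun_eq_iff field_simps)
    done
qed

lemma critical_points_iff:
  fixes x1 y1 x2 y2 c :: real
  defines "d \<equiv> (x2 - x1)\<^sup>2 + (y2 - y1)\<^sup>2"
  defines "u \<equiv> 1 - (x1\<^sup>2 + y1\<^sup>2)" and "w \<equiv> 1 - (x2\<^sup>2 + y2\<^sup>2)"
  shows "(x1, y1, x2, y2) \<in> critical_points c \<longleftrightarrow> (x1, y1, x2, y2) \<in> phase_space \<and>
    (\<exists>l. c * (x2 - x1) / d - x1 / u = l * x1 \<and> c * (y2 - y1) / d - y1 / u = l * y1
      \<and> c * (x2 - x1) / d + x2 / w = - (l * x2) \<and> c * (y2 - y1) / d + y2 / w = - (l * y2))"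
proof (cases "(x1, y1, x2, y2) \<in> phase_space")
  case True
  define A where "A = (\<lambda>v::real \<times> real \<times> real \<times> real.
    2 * x1 * fst v + 2 * y1 * fst (snd v) + 2 * x2 * fst (snd (snd v)) + 2 * y2 * snd (snd (snd v)))"
  define B where "B = (\<lambda>v::real \<times> real \<times> real \<times> real.
    (c * (x2 - x1) / d - x1 / u) * fst v + (c * (y2 - y1) / d - y1 / u) * fst (snd v)
      - (c * (x2 - x1) / d + x2 / w) * fst (snd (snd v)) - (c * (y2 - y1) / d + y2 / w) * snd (snd (snd v)))"
  have D: "frechet_derivative (momentum_map c) (at (x1, y1, x2, y2)) = (\<lambda>v. (A v, B v))"
    using frechet_derivative_at[OF momentum_map_has_derivative[OF True], of c, symmetric]
    by (simp only: A_def B_def d_def u_def w_def)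
  \<comment> \<open>Distinct vortices are not both at the centre, so dF does not vanish and the
    multiplier can be attached to dF.\<close>
  have "\<not> (x1 = x2 \<and> y1 = y2)" using True by (auto simp: phase_space_def)
  then have "x1 \<noteq> 0 \<or> y1 \<noteq> 0 \<or> x2 \<noteq> 0 \<or> y2 \<noteq> 0" by auto
  then have "A (x1, 0) \<noteq> 0 \<or> A (0, y1, 0) \<noteq> 0 \<or> A (0, 0, x2, 0) \<noteq> 0 \<or> A (0, 0, 0, y2) \<noteq> 0"
    by (auto simp: A_def zero_prod_def)
  then obtain v0 where v0: "A v0 \<noteq> 0" by blast
  have "(\<exists>l. \<forall>v. B v = l * A v) \<longleftrightarrow> (\<exists>l. c * (x2 - x1) / d - x1 / u = l * x1 \<and> c * (y2 - y1) / d - y1 / u = l * y1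
      \<and> c * (x2 - x1) / d + x2 / w = - (l * x2) \<and> c * (y2 - y1) / d + y2 / w = - (l * y2))"
  proof (intro iffI; elim exE)
    fix l assume "\<forall>v. B v = l * A v"
    then have *: "B v = l * A v" for v by blast
    \<comment> \<open>Evaluation on the four basis vectors; the factor 2 in the multiplier comes
      from dF.\<close>
    show "\<exists>l. c * (x2 - x1) / d - x1 / u = l * x1 \<and> c * (y2 - y1) / d - y1 / u = l * y1
      \<and> c * (x2 - x1) / d + x2 / w = - (l * x2) \<and> c * (y2 - y1) / d + y2 / w = - (l * y2)"
      by (intro exI[of _ "2 * l"]) (use *[of "(1,0,0,0)"] *[of "(0,1,0,0)"] *[of "(0,0,1,0)"] *[of "(0,0,0,1)"]
        in \<open>simp add: A_def B_def\<close>)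
  next
    fix l assume *: "c * (x2 - x1) / d - x1 / u = l * x1 \<and> c * (y2 - y1) / d - y1 / u = l * y1
      \<and> c * (x2 - x1) / d + x2 / w = - (l * x2) \<and> c * (y2 - y1) / d + y2 / w = - (l * y2)"
    have "B v = l / 2 * A v" for v
    proof -
      have "B v = l * x1 * fst v + l * y1 * fst (snd v)
          - - (l * x2) * fst (snd (snd v)) - - (l * y2) * snd (snd (snd v))"
        unfolding B_def by (simp only: *)
      then show ?thesis by (simp add: A_def algebra_simps)
    qed
    then show "\<exists>l. \<forall>v. B v = l * A v" by blast
  qed
  then show ?thesis
    using True dim_range_prod_less_2_iff[of A, OF v0] by (simp add: critical_points_def D)
qed (auto simp: critical_points_def)

section \<open>The bifurcation diagram\<close>

text \<open>Here \<open>p\<close> stands for -q and \<open>f\<close> for r1 + r2. Then 1 - f + p^2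
  is (1 - r1) (1 - r2) and f + 2 p is d, so the right-hand side is the value of (F, H). The equation
  for \<open>f\<close> is p d = c (1 - r1) (1 - r2) multiplied out.\<close>

lemma gamma2_eqI:
  fixes c p f :: real
  assumes "c > 0" "p > 0" and f: "f * (c + p) = c * (1 + p\<^sup>2) - 2 * p\<^sup>2"
  shows "gamma2 c (1 + p) = (f, 1/2 * ln (1 - f + p\<^sup>2) - c/2 * ln (f + 2 * p))"
proof -
  have "f = (c * (1 + p\<^sup>2) - 2 * p\<^sup>2) / (c + p)" using assms by (simp add: field_simps)
  then have "(c * (1 + p)\<^sup>2 - 2 * p * (c + p)) / (c + p) = f"
    "(1 + p)\<^sup>2 * p / (c + p) = 1 - f + p\<^sup>2"
    "c * (1 + p)\<^sup>2 / (c + p) = f + 2 * p"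
    using assms(1,2) by (simp_all add: field_simps power2_eq_square)
  moreover have "1 + p - 1 = p" "c + (1 + p) - 1 = c + p" by simp_all
  ultimately show ?thesis by (simp only: gamma2_def)
qed

lemma s_tangency_less_2:
  assumes "c > 0"
  shows "s_tangency c < 2"
  using assms by (simp add: s_tangency_def field_simps add_pos_pos)

text \<open>Both parts compare 2 p with \<open>sqrt c\<close> (1 - p). The squared version is what 2
  p \<le> f becomes once f is eliminated.\<close>

lemma le_s_tangency_iff:
  assumes "c > 0" "0 < p" "p < 1"
  shows "1 + p \<le> s_tangency c \<longleftrightarrow> 4 * p\<^sup>2 \<le> c * (1 - p)\<^sup>2"
    and "1 + p = s_tangency c \<longleftrightarrow> 4 * p\<^sup>2 = c * (1 - p)\<^sup>2"
proof -
  have k: "sqrt c > 0" using assms by simp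
  have e: "c * (1 - p)\<^sup>2 = (sqrt c * (1 - p))\<^sup>2" "4 * p\<^sup>2 = (2 * p)\<^sup>2"
    using assms by (simp_all add: power_mult_distrib)
  have nn: "0 \<le> sqrt c * (1 - p)" "0 \<le> 2 * p" using assms by auto
  have q1: "4 * p\<^sup>2 \<le> c * (1 - p)\<^sup>2 \<longleftrightarrow> 2 * p \<le> sqrt c * (1 - p)"
    unfolding e using power_mono_iff[OF nn(2,1), of 2] by simp
  have q2: "4 * p\<^sup>2 = c * (1 - p)\<^sup>2 \<longleftrightarrow> 2 * p = sqrt c * (1 - p)"
    unfolding e using power2_eq_iff_nonneg[OF nn(2,1)] by simp
  have s1: "1 + p \<le> s_tangency c \<longleftrightarrow> (1 + p) * (2 + sqrt c) \<le> 2 * (1 + sqrt c)"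
    unfolding s_tangency_def using k by (intro pos_le_divide_eq add_pos_pos) simp_all
  have s2: "1 + p = s_tangency c \<longleftrightarrow> (1 + p) * (2 + sqrt c) = 2 * (1 + sqrt c)"
    unfolding s_tangency_def using add_pos_pos[OF zero_less_two k] by (intro nonzero_eq_divide_eq) simp
  have s3: "(1 + p) * (2 + sqrt c) = 2 * (1 + sqrt c) + (2 * p - sqrt c * (1 - p))"
    by (simp add: algebra_simps)
  show "1 + p \<le> s_tangency c \<longleftrightarrow> 4 * p\<^sup>2 \<le> c * (1 - p)\<^sup>2"
    unfolding s1 q1 s3 by auto
  show "1 + p = s_tangency c \<longleftrightarrow> 4 * p\<^sup>2 = c * (1 - p)\<^sup>2"
    unfolding s2 q2 s3 by auto
qed

section \<open>Critical values lie on the two curves\<close>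

lemma critical_value_cases:
  assumes c: "c > 0" and crit: "(x1, y1, x2, y2) \<in> critical_points c"
  shows "momentum_map c (x1, y1, x2, y2) \<in> gamma1 c ` gamma1_domain \<union> gamma2 c ` gamma2_domain c"
proof -
  define d where "d = (x2 - x1)\<^sup>2 + (y2 - y1)\<^sup>2"
  define r1 where "r1 = x1\<^sup>2 + y1\<^sup>2"
  define r2 where "r2 = x2\<^sup>2 + y2\<^sup>2"
  define q where "q = x1 * x2 + y1 * y2"
  have "(x1, y1, x2, y2) \<in> phase_space" using crit by (simp add: critical_points_def)
  then have r: "r1 < 1" "r2 < 1" and ne: "\<not> (x1 = x2 \<and> y1 = y2)"
    by (auto simp: phase_space_def r1_def r2_def)
  have d: "d > 0" using ne by (auto simp: d_def sum_power2_gt_zero_iff)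
  have dq: "d = r1 + r2 - 2 * q" by (simp add: d_def r1_def r2_def q_def power2_eq_square algebra_simps)
  define k where "k = c / d"
  have k: "k > 0" using c d by (simp add: k_def)
  obtain l where l: "k * (x2 - x1) - x1 / (1 - r1) = l * x1" "k * (y2 - y1) - y1 / (1 - r1) = l * y1"
    "k * (x2 - x1) + x2 / (1 - r2) = - (l * x2)" "k * (y2 - y1) + y2 / (1 - r2) = - (l * y2)"
    using crit unfolding critical_points_iff by (auto simp: k_def d_def r1_def r2_def)
  \<comment> \<open>In this notation the Lagrange equations read k (z2 - z1) = m1 z1 = - m2 z2 for
    the positions z1, z2 of the vortices, and \<open>l\<close> drops out of m1 - m2.\<close>
  define m1 where "m1 = l + 1 / (1 - r1)"
  define m2 where "m2 = l + 1 / (1 - r2)"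
  have m: "k * (x2 - x1) = m1 * x1" "k * (y2 - y1) = m1 * y1" 
    "k * (x2 - x1) = - m2 * x2" "k * (y2 - y1) = - m2 * y2"
    using l by (simp_all add: m1_def m2_def algebra_simps)
  have "x1 * (k * (y2 - y1)) = y1 * (k * (x2 - x1))" unfolding m(1,2) by simp
  then have "k * (x1 * y2 - y1 * x2) = 0" by (simp add: algebra_simps)
  then have cross: "x1 * y2 = y1 * x2" using k by simp
  have q2: "q\<^sup>2 = r1 * r2"
  proof -
    have "r1 * r2 = q\<^sup>2 + (x1 * y2 - y1 * x2)\<^sup>2"
      by (simp add: q_def r1_def r2_def power2_eq_square algebra_simps)
    then show ?thesis using cross by simp
  qed
  \<comment> \<open>A vortex at the centre would force k (z2 - z1) = 0, hence a collision.\<close>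
  have "r1 \<noteq> 0" using m(1,2) k ne by (auto simp: r1_def)
  moreover have "r2 \<noteq> 0" using m(3,4) k ne by (auto simp: r2_def)
  ultimately have rpos: "r1 > 0" "r2 > 0" by (auto simp: r1_def r2_def less_le)
  then have q0: "q \<noteq> 0" using q2 by auto
  \<comment> \<open>Inner products with z1 and z2 turn the vector equations into scalar
    ones.\<close>
  have "k * (q - r1) = x1 * (k * (x2 - x1)) + y1 * (k * (y2 - y1))"
    by (simp add: q_def r1_def power2_eq_square algebra_simps)
  also have "\<dots> = m1 * r1" unfolding m(1,2) by (simp add: r1_def power2_eq_square algebra_simps)
  finally have g1: "k * (q - r1) = m1 * r1" .
  have "k * (r2 - q) = x2 * (k * (x2 - x1)) + y2 * (k * (y2 - y1))"
    by (simp add: q_def r2_def power2_eq_square algebra_simps)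
  also have "\<dots> = - m2 * r2" unfolding m(3,4) by (simp add: r2_def power2_eq_square algebra_simps)
  finally have g2: "k * (q - r2) = m2 * r2" by (simp add: algebra_simps)
  have "(m1 - m2) * r1 * r2 = (m1 * r1) * r2 - (m2 * r2) * r1" by (simp add: algebra_simps)
  also have "\<dots> = k * q * (r2 - r1)" unfolding g1[symmetric] g2[symmetric] by (simp add: algebra_simps)
  finally have "(m1 - m2) * q\<^sup>2 = k * q * (r2 - r1)" by (simp add: q2)
  then have kq: "(m1 - m2) * q = k * (r2 - r1)" using q0 by (simp add: power2_eq_square)
  \<comment> \<open>A second expression for m1 - m2, from the definitions; comparison with
    \<open>kq\<close> yields the factorization.\<close>
  have "m1 - m2 = 1 / (1 - r1) - 1 / (1 - r2)" by (simp add: m1_def m2_def)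
  also have "\<dots> = (r1 - r2) / ((1 - r1) * (1 - r2))" using r by (simp add: divide_simps)
  finally have "m1 - m2 = (r1 - r2) / ((1 - r1) * (1 - r2))" .
  with kq have "(r1 - r2) * q = k * (r2 - r1) * ((1 - r1) * (1 - r2))"
    using r by (simp add: divide_simps mult_ac split: if_splits)
  then have "(r1 - r2) * (q + k * ((1 - r1) * (1 - r2))) = 0" by (simp add: algebra_simps)
  then consider (eq) "r1 = r2" | (ne) "q = - (k * ((1 - r1) * (1 - r2)))" by auto
  then show ?thesis
  proof cases
    case eq
    \<comment> \<open>The vortices lie on one line at equal distance from the centre; q = r1 would
      be a collision, so they are antipodal.\<close>
    then have "(q - r1) * (q + r1) = 0" using q2 by (simp add: power2_eq_square algebra_simps)
    moreover have "q \<noteq> r1" using d dq eq by auto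
    ultimately have "q = - r1" by auto
    then have "d = 4 * r1" using dq eq by simp
    then have "momentum_map c (x1, y1, x2, y2) = gamma1 c (2 * r1)"
      using eq by (simp add: momentum_map_def moment_of_vorticity_def hamiltonian_def gamma1_def
          flip: d_def) (simp add: r1_def r2_def)
    moreover have "2 * r1 \<in> gamma1_domain" using r rpos by (simp add: gamma1_domain_def)
    ultimately show ?thesis by blast
  next
    case ne
    \<comment> \<open>In this case q is negative: the vortices lie on opposite sides of the
      centre.\<close>
    define p where "p = - q"
    have p: "p > 0" using ne k r by (simp add: p_def)
    have "p\<^sup>2 < 1" using q2 r rpos mult_strict_mono[of r1 1 r2 1] by (simp add: p_def)
    then have p1: "p < 1" using p by (simp add: power2_less_1_iff abs_less_iff)
    have pd: "p * d = c * ((1 - r1) * (1 - r2))" using ne d by (simp add: p_def k_def)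
    have prod: "(1 - r1) * (1 - r2) = 1 - (r1 + r2) + p\<^sup>2" using q2 by (simp add: p_def algebra_simps)
    have f: "(r1 + r2) * (c + p) = c * (1 + p\<^sup>2) - 2 * p\<^sup>2"
      using pd unfolding prod dq by (simp add: p_def power2_eq_square algebra_simps)
    have "hamiltonian c (x1, y1, x2, y2) = 1/2 * ln ((1 - r1) * (1 - r2)) - c/2 * ln d"
      using r by (simp add: hamiltonian_def ln_mult d_def r1_def r2_def)
    then have "momentum_map c (x1, y1, x2, y2) = gamma2 c (1 + p)"
      unfolding gamma2_eqI[OF c p f] 
      by (simp add: momentum_map_def moment_of_vorticity_def prod dq p_def) (simp add: r1_def r2_def)
    moreover have "4 * p\<^sup>2 \<le> c * (1 - p)\<^sup>2"
    proof -
      \<comment> \<open>The inequality 2 p \<le> r1 + r2 between geometric and arithmetic mean,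
        multiplied by c + p, is the bound on the parameter.\<close>
      have "(2 * p)\<^sup>2 \<le> (r1 + r2)\<^sup>2"
        using q2 zero_le_power2[of "r1 - r2"] by (simp add: p_def power2_eq_square algebra_simps)
      then have "2 * p \<le> r1 + r2" by (rule power2_le_imp_le) (use rpos in simp)
      then have "2 * p * (c + p) \<le> (r1 + r2) * (c + p)" using c p by (intro mult_right_mono) auto
      then show ?thesis unfolding f by (simp add: power2_eq_square algebra_simps)
    qed
    then have "1 + p \<in> gamma2_domain c"
      using le_s_tangency_iff(1)[OF c p p1] p by (simp add: gamma2_domain_def)
    ultimately show ?thesis by blast
  qed
qed

section \<open>Points of the two curves as critical values\<close>

lemma gamma1_critical:
  assumes c: "c > 0" and f: "f \<in> gamma1_domain"
  shows "gamma1 c f \<in> bifurcation_diagram c"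
proof -
  \<comment> \<open>An antipodal pair at distance \<open>a\<close> from the centre has F = 2 a^2 =
    f.\<close>
  define a where "a = sqrt (f / 2)"
  have a: "a > 0" "a\<^sup>2 = f / 2" "f < 2" using f by (auto simp: a_def gamma1_domain_def)
  have "(a, 0, -a, 0) \<in> phase_space" using a by (simp add: phase_space_def)
  moreover have "c * (- a - a) / (- a - a)\<^sup>2 = - (c / (2 * a\<^sup>2)) * a"
    using a(1) by (simp add: field_simps power2_eq_square)
  ultimately have crit: "(a, 0, -a, 0) \<in> critical_points c"
    unfolding critical_points_iff
    by (auto intro!: exI[of _ "- (c / (2 * a\<^sup>2)) - 1 / (1 - a\<^sup>2)"] simp: algebra_simps)
  have "gamma1 c f = momentum_map c (a, 0, -a, 0)"
    using a by (simp add: momentum_map_def moment_of_vorticity_def hamiltonian_def gamma1_def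
        power2_eq_square algebra_simps)
  then show ?thesis unfolding bifurcation_diagram_def using crit by (rule image_eqI)
qed

lemma gamma2_critical:
  assumes c: "c > 0" and s: "s \<in> gamma2_domain c"
  shows "gamma2 c s \<in> bifurcation_diagram c"
proof -
  define p where "p = s - 1"
  have p: "p > 0" "p < 1" and "4 * p\<^sup>2 \<le> c * (1 - p)\<^sup>2"
    using s s_tangency_less_2[OF c] le_s_tangency_iff(1)[OF c, of p] by (auto simp: p_def gamma2_domain_def)
  define f where "f = (c * (1 + p\<^sup>2) - 2 * p\<^sup>2) / (c + p)"
  have f: "f * (c + p) = c * (1 + p\<^sup>2) - 2 * p\<^sup>2" using c p by (simp add: f_def)
  have "2 * p * (c + p) \<le> f * (c + p)"
    using \<open>4 * p\<^sup>2 \<le> _\<close> unfolding f by (simp add: power2_eq_square algebra_simps)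
  then have fp: "2 * p \<le> f" using c p by (simp add: mult_le_cancel_right)
  \<comment> \<open>A pair a, b on the x-axis with a b = -p and a^2 + b^2 = f satisfies (a - b)^2 =
    f + 2 p and (a + b)^2 = f - 2 p; \<open>S\<close> and \<open>D\<close> are the roots chosen for
    a - b and a + b.\<close>
  define S where "S = sqrt (f + 2 * p)"
  define D where "D = sqrt (f - 2 * p)"
  have S: "S\<^sup>2 = f + 2 * p" "S > 0" and D: "D\<^sup>2 = f - 2 * p" using p fp by (auto simp: S_def D_def)
  define a where "a = (S + D) / 2"
  define b where "b = (D - S) / 2"
  have ab: "a * b = - p" and a2b2: "a\<^sup>2 + b\<^sup>2 = f" and d: "(b - a)\<^sup>2 = f + 2 * p" and "b \<noteq> a"
    using S D by (auto simp: a_def b_def power2_eq_square field_simps)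
  have prod: "(1 - a\<^sup>2) * (1 - b\<^sup>2) = 1 - f + p\<^sup>2"
    using arg_cong[OF ab, of "\<lambda>x. x\<^sup>2"] a2b2 by (simp add: power2_eq_square algebra_simps)
  \<comment> \<open>This makes (1 - a^2) (1 - b^2) positive, so a^2 and b^2 lie on the same side of
    1; a^2 b^2 = p^2 < 1 then rules out that both exceed 1.\<close>
  have pd: "c * (1 - f + p\<^sup>2) = p * (f + 2 * p)"
    using f by (simp add: power2_eq_square algebra_simps)
  moreover have "p * (f + 2 * p) > 0" using p fp by simp
  ultimately have "1 - f + p\<^sup>2 > 0" using c by (metis zero_less_mult_pos)
  then have pos: "(1 - a\<^sup>2) * (1 - b\<^sup>2) > 0" by (simp add: prod)
  have lt: "a\<^sup>2 * b\<^sup>2 < 1"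
    using p arg_cong[OF ab, of "\<lambda>x. x\<^sup>2"] by (simp add: power_mult_distrib power2_less_1_iff abs_less_iff)
  have *: "a\<^sup>2 < 1 \<and> b\<^sup>2 < 1"
  proof (rule ccontr)
    assume "\<not> ?thesis"
    then have "a\<^sup>2 > 1 \<and> b\<^sup>2 > 1" using pos by (auto simp: zero_less_mult_iff)
    then show False using lt less_1_mult[of "a\<^sup>2" "b\<^sup>2"] by simp
  qed
  then have ps: "(a, 0, b, 0) \<in> phase_space" using \<open>b \<noteq> a\<close> by (simp add: phase_space_def)
  \<comment> \<open>The equation of the first vortex determines \<open>l\<close>. The y-components
    vanish, so only the x-equation of the second vortex remains to be checked.\<close>
  define l where "l = (c * (b - a) / (b - a)\<^sup>2 - a / (1 - a\<^sup>2)) / a"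
  have ab0: "a \<noteq> 0" "b \<noteq> 0" using ab p by auto
  have "c * (b - a) / (b - a)\<^sup>2 + b / (1 - b\<^sup>2) = - (l * b)"
  proof -
    have l: "l = c / (a * (b - a)) - 1 / (1 - a\<^sup>2)"
      using ab0 \<open>b \<noteq> a\<close> by (simp add: l_def power2_eq_square diff_divide_distrib)
    have "c * ((1 - a\<^sup>2) * (1 - b\<^sup>2)) = - (a * b) * (b - a)\<^sup>2" unfolding prod d ab using pd by simp
    then have "c / ((a * b) * (b - a)\<^sup>2) = - 1 / ((1 - a\<^sup>2) * (1 - b\<^sup>2))"
      using ab0 \<open>b \<noteq> a\<close> * by (simp add: divide_simps)
    \<comment> \<open>The factor b^2 - a^2 splits both sides into partial fractions with one term
      for each vortex.\<close>
    then have "(b\<^sup>2 - a\<^sup>2) * (c / ((a * b) * (b - a)\<^sup>2)) = (b\<^sup>2 - a\<^sup>2) * (- 1 / ((1 - a\<^sup>2) * (1 - b\<^sup>2)))"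
      by simp
    moreover have "(b\<^sup>2 - a\<^sup>2) * (c / ((a * b) * (b - a)\<^sup>2)) = c / (a * (b - a)) + c / (b * (b - a))"
      using ab0 \<open>b \<noteq> a\<close> by (simp add: divide_simps) (simp add: power2_eq_square algebra_simps)
    moreover have "(b\<^sup>2 - a\<^sup>2) * (- 1 / ((1 - a\<^sup>2) * (1 - b\<^sup>2))) = 1 / (1 - a\<^sup>2) - 1 / (1 - b\<^sup>2)"
      using * by (simp add: divide_simps)
    ultimately have "c / (b * (b - a)) + 1 / (1 - b\<^sup>2) = - l" by (simp add: l)
    then have "b * (c / (b * (b - a)) + 1 / (1 - b\<^sup>2)) = - (l * b)" by simp
    moreover have "b * (c / (b * (b - a)) + 1 / (1 - b\<^sup>2)) = c * (b - a) / (b - a)\<^sup>2 + b / (1 - b\<^sup>2)"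
      using ab0 \<open>b \<noteq> a\<close> by (simp add: distrib_left power2_eq_square)
    ultimately show ?thesis by simp
  qed
  then have crit: "(a, 0, b, 0) \<in> critical_points c"
    unfolding critical_points_iff using ps ab0 by (auto intro!: exI[of _ l] simp: l_def)
  have "gamma2 c s = momentum_map c (a, 0, b, 0)"
  proof -
    have "gamma2 c s = (f, 1/2 * ln (1 - f + p\<^sup>2) - c/2 * ln (f + 2 * p))"
      using gamma2_eqI[OF c p(1) f] by (simp add: p_def)
    also have "\<dots> = momentum_map c (a, 0, b, 0)"
      using * a2b2 unfolding prod[symmetric] d[symmetric]
      by (simp add: momentum_map_def moment_of_vorticity_def hamiltonian_def ln_mult)
    finally show ?thesis .
  qed
  then show ?thesis unfolding bifurcation_diagram_def using crit by (rule image_eqI)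
qed

theorem bifurcation_diagram_eq:
  assumes c: "c > 0"
  shows "bifurcation_diagram c = gamma1 c ` gamma1_domain \<union> gamma2 c ` gamma2_domain c"
proof
  show "bifurcation_diagram c \<subseteq> gamma1 c ` gamma1_domain \<union> gamma2 c ` gamma2_domain c"
    unfolding bifurcation_diagram_def
  proof (rule image_subsetI)
    fix z assume z: "z \<in> critical_points c"
    obtain x1 y1 x2 y2 where "z = (x1, y1, x2, y2)" by (rule prod_cases4)
    with z show "momentum_map c z \<in> gamma1 c ` gamma1_domain \<union> gamma2 c ` gamma2_domain c"
      using critical_value_cases[OF c] by blast
  qed
  show "gamma1 c ` gamma1_domain \<union> gamma2 c ` gamma2_domain c \<subseteq> bifurcation_diagram c"
    using gamma1_critical[OF c] gamma2_critical[OF c] by blast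
qed

section \<open>Tangent directions from secant slopes\<close>

text \<open>The nearest point is the orthogonal projection \<open>k *\<^sub>R v\<close>, by
  Pythagoras; Lagrange's identity then rewrites its distance as a planar cross product.\<close>

lemma infdist_span_singleton:
  fixes v w :: "real \<times> real"
  assumes "v \<noteq> 0"
  shows "infdist w (span {v}) = \<bar>fst w * snd v - snd w * fst v\<bar> / norm v"
proof -
  have nv: "norm v > 0"
    using assms by simp
  define k where "k = (w \<bullet> v) / (norm v)\<^sup>2"
  have orth: "(w - k *\<^sub>R v) \<bullet> v = 0"
    using nv assms by (simp add: k_def inner_diff_left power2_norm_eq_inner)
  have min: "dist w (k *\<^sub>R v) \<le> dist w x" if x: "x \<in> span {v}" for x
  proof -
    obtain j where j: "x = j *\<^sub>R v" using x by (auto simp: span_singleton)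
    have "orthogonal (w - k *\<^sub>R v) ((k - j) *\<^sub>R v)"
      using orth by (simp add: orthogonal_def)
    from norm_add_Pythagorean[OF this]
    have "(norm (w - x))\<^sup>2 = (norm (w - k *\<^sub>R v))\<^sup>2 + (norm ((k - j) *\<^sub>R v))\<^sup>2"
      by (simp add: j algebra_simps)
    then have "(norm (w - k *\<^sub>R v))\<^sup>2 \<le> (norm (w - x))\<^sup>2" by simp
    then show ?thesis by (simp add: dist_norm)
  qed
  have "k *\<^sub>R v \<in> span {v}" by (simp add: span_base span_mul)
  then have "infdist w (span {v}) = dist w (k *\<^sub>R v)"
    by (intro antisym infdist_le) (auto simp: infdist_def intro!: cINF_greatest min)
  also have "\<dots> = \<bar>fst w * snd v - snd w * fst v\<bar> / norm v"
  proof (rule power2_eq_imp_eq)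
    have "(dist w (k *\<^sub>R v))\<^sup>2 = (norm w)\<^sup>2 - (w \<bullet> v)\<^sup>2 / (norm v)\<^sup>2"
      using nv unfolding dist_norm power2_norm_eq_inner k_def
      by (simp add: inner_diff_left inner_diff_right inner_commute field_simps power2_eq_square)
    also have "\<dots> = (fst w * snd v - snd w * fst v)\<^sup>2 / (norm v)\<^sup>2"
    proof -
      have "(norm w)\<^sup>2 * (norm v)\<^sup>2 = (fst w * snd v - snd w * fst v)\<^sup>2 + (w \<bullet> v)\<^sup>2"
        unfolding power2_norm_eq_inner by (cases v; cases w) (simp add: power2_eq_square algebra_simps)
      then show ?thesis using nv by (simp add: field_simps)
    qed
    finally show "(dist w (k *\<^sub>R v))\<^sup>2 = (\<bar>fst w * snd v - snd w * fst v\<bar> / norm v)\<^sup>2"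
      by (simp add: power_divide)
  qed (use nv in auto)
  finally show ?thesis .
qed

text \<open>The relative distance to the line is a continuous function of the secant slope
  \<open>r\<close>, so its limit is obtained by putting \<open>m\<close> for \<open>r\<close>.
  Working with secants, the criterion also covers points where the derivative of \<open>g\<close>
  vanishes.\<close>

lemma has_tangent_direction_iff_slope:
  assumes t: "t \<in> S" "t islimpt S"
    and ne: "\<forall>\<^sub>F u in at t within S. fst (g u) \<noteq> fst (g t)"
    and lim: "((\<lambda>u. (snd (g u) - snd (g t)) / (fst (g u) - fst (g t))) \<longlongrightarrow> m) (at t within S)"
  shows "has_tangent_direction g S t v \<longleftrightarrow> v \<noteq> 0 \<and> snd v = m * fst v"
proof (cases "v = 0")
  case False
  define r where "r = (\<lambda>u. (snd (g u) - snd (g t)) / (fst (g u) - fst (g t)))"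
  let ?q = "\<lambda>u. infdist (g u - g t) (span {v}) / norm (g u - g t)"
  have eq: "?q u = \<bar>snd v - r u * fst v\<bar> / (norm v * sqrt (1 + (r u)\<^sup>2))"
    if "fst (g u) \<noteq> fst (g t)" for u
  proof -
    define x where "x = fst (g u) - fst (g t)"
    have x: "x \<noteq> 0" "snd (g u) - snd (g t) = r u * x" using that by (auto simp: x_def r_def)
    have "norm (g u - g t) = sqrt (x\<^sup>2 * (1 + (r u)\<^sup>2))"
      using x by (simp add: norm_prod_def flip: x_def) (simp add: algebra_simps power_mult_distrib)
    also have "\<dots> = \<bar>x\<bar> * sqrt (1 + (r u)\<^sup>2)" by (simp add: real_sqrt_mult)
    finally have n: "norm (g u - g t) = \<bar>x\<bar> * sqrt (1 + (r u)\<^sup>2)" .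
    have "infdist (g u - g t) (span {v}) = \<bar>x * (snd v - r u * fst v)\<bar> / norm v"
      using x by (simp add: infdist_span_singleton[OF False] flip: x_def) (simp add: algebra_simps)
    then show ?thesis using x n by (simp add: abs_mult)
  qed
  have "((\<lambda>u. \<bar>snd v - r u * fst v\<bar> / (norm v * sqrt (1 + (r u)\<^sup>2)))
      \<longlongrightarrow> \<bar>snd v - m * fst v\<bar> / (norm v * sqrt (1 + m\<^sup>2))) (at t within S)"
    using lim False by (intro tendsto_intros) (auto simp: r_def add_nonneg_eq_0_iff)
  then have L: "(?q \<longlongrightarrow> \<bar>snd v - m * fst v\<bar> / (norm v * sqrt (1 + m\<^sup>2))) (at t within S)"
    by (rule Lim_transform_eventually) (use ne eq in \<open>auto elim!: eventually_mono\<close>)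
  \<comment> \<open>As \<open>t\<close> is a limit point, limits are unique, and convergence to 0
    forces the computed limit to be 0.\<close>
  have nb: "at t within S \<noteq> bot" using t by (simp add: trivial_limit_within)
  then have "(?q \<longlongrightarrow> 0) (at t within S) \<longleftrightarrow> \<bar>snd v - m * fst v\<bar> / (norm v * sqrt (1 + m\<^sup>2)) = 0"
    using tendsto_unique[OF nb L, of 0] L by (intro iffI) simp_all
  also have "\<dots> \<longleftrightarrow> snd v = m * fst v" using False by (auto simp: add_nonneg_eq_0_iff)
  finally have "(?q \<longlongrightarrow> 0) (at t within S) \<longleftrightarrow> snd v = m * fst v" .
  moreover have "\<forall>\<^sub>F u in at t within S. g u \<noteq> g t" using ne by eventually_elim auto
  ultimately show ?thesis using False t by (simp add: has_tangent_direction_def)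
qed (simp add: has_tangent_direction_def)

section \<open>Slopes of the two curves\<close>

text \<open>This is f' along \<open>gamma2\<close>, read off from f = (c - 2) s + const + c (c -
  1)^2 / (c + s - 1).\<close>

definition gamma2_df :: "real \<Rightarrow> real \<Rightarrow> real" where
  "gamma2_df c s = (c - 2) - c * (c - 1)\<^sup>2 / (c + s - 1)\<^sup>2"

text \<open>Partial fractions of the quotient \<open>h'/f' = - (c + s - 1) / (2 s (s - 1))\<close> along \<open>gamma2\<close>.\<close>

definition gamma2_slope :: "real \<Rightarrow> real \<Rightarrow> real" where
  "gamma2_slope c s = (c - 1) / (2 * s) - c / (2 * (s - 1))"

text \<open>The right-hand side is the derivative of h after its logarithms are split into those of
  s - 1, s and c + s - 1, so this is h' = m f'.\<close>

lemma gamma2_dh_eq: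
  assumes "c > 0" "s > 1"
  shows "gamma2_slope c s * gamma2_df c s = 1/2 / (s - 1) + (1 - c) / s + (c - 1)/2 / (c + s - 1)"
proof -
  have "c + s - 1 > 0" using assms by simp
  then show ?thesis using assms
    by (simp add: gamma2_slope_def gamma2_df_def divide_simps power2_eq_square) (simp add: algebra_simps)
qed

lemma gamma2_has_real_derivative:
  assumes c: "c > 0" and s: "s > 1"
  shows "((\<lambda>s. fst (gamma2 c s)) has_real_derivative gamma2_df c s) (at s)"
    and "((\<lambda>s. snd (gamma2 c s)) has_real_derivative gamma2_slope c s * gamma2_df c s) (at s)"
proof -
  have q: "c + s - 1 > 0" using assms by simp
  show "((\<lambda>s. fst (gamma2 c s)) has_real_derivative gamma2_df c s) (at s)"
    unfolding gamma2_def fst_conv using q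
    by (auto intro!: derivative_eq_intros simp: gamma2_df_def divide_simps power2_eq_square)
       (simp add: algebra_simps)
  \<comment> \<open>The logarithms split only for positive arguments, hence an equality near
    \<open>s\<close> and not everywhere.\<close>
  have ev: "\<forall>\<^sub>F x in nhds s. snd (gamma2 c x) = 1/2 * ln (x - 1) + (1 - c) * ln x
     + (c - 1)/2 * ln (c + x - 1) - c/2 * ln c"
  proof (rule eventually_nhds_in_open[of "{1<..}", THEN eventually_mono])
    fix x :: real assume "x \<in> {1<..}"
    then have x: "x > 1" "c + x - 1 > 0" using c by auto
    then have "ln (x\<^sup>2 * (x - 1) / (c + x - 1)) = 2 * ln x + ln (x - 1) - ln (c + x - 1)"
      "ln (c * x\<^sup>2 / (c + x - 1)) = ln c + 2 * ln x - ln (c + x - 1)"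
      using c by (simp_all add: ln_div ln_mult ln_realpow)
    then show "snd (gamma2 c x) = 1/2 * ln (x - 1) + (1 - c) * ln x
     + (c - 1)/2 * ln (c + x - 1) - c/2 * ln c"
      by (simp add: gamma2_def) (simp add: field_simps)
  qed (use s in auto)
  have "((\<lambda>x. 1/2 * ln (x - 1) + (1 - c) * ln x + (c - 1)/2 * ln (c + x - 1) - c/2 * ln c)
      has_real_derivative gamma2_slope c s * gamma2_df c s) (at s)"
    unfolding gamma2_dh_eq[OF assms] using q s
    by (auto intro!: derivative_eq_intros simp: divide_simps) (simp add: algebra_simps)
  then show "((\<lambda>s. snd (gamma2 c s)) has_real_derivative gamma2_slope c s * gamma2_df c s) (at s)"
    by (subst DERIV_cong_ev[OF refl ev refl])
qed

lemma gamma2_df_eq: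
  assumes "c > 0" "s > 1"
  shows "gamma2_df c s = ((c - 2) * (s - 1) * (s - 1 + 2 * c) - c) / (c + s - 1)\<^sup>2"
proof -
  have "c + s - 1 > 0" using assms by simp
  then show ?thesis by (simp add: gamma2_df_def divide_simps) (simp add: power2_eq_square algebra_simps)
qed

text \<open>With p = s - 1 > 0 a zero solves (c - 2) p (p + 2 c) = c. This excludes c = 2, and p (p
  + 2 c) is injective for p > 0.\<close>

lemma gamma2_df_zero_unique:
  assumes c: "c > 0" and "s > 1" "t > 1" "gamma2_df c s = 0" "gamma2_df c t = 0"
  shows "s = t"
proof -
  have eq: "(c - 2) * ((s - 1) * (s - 1 + 2 * c)) = c" "(c - 2) * ((t - 1) * (t - 1 + 2 * c)) = c"
    using assms by (auto simp: gamma2_df_eq mult.assoc)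
  then have "c - 2 \<noteq> 0" using c by auto
  then have "(s - 1) * (s - 1 + 2 * c) = (t - 1) * (t - 1 + 2 * c)" using eq by (metis mult_left_cancel)
  then have "(s - t) * (s + t - 2 + 2 * c) = 0" by (simp add: algebra_simps)
  moreover have "s + t - 2 + 2 * c > 0" using assms by simp
  ultimately show ?thesis by auto
qed

text \<open>If \<open>t\<close> is a zero, it is the only one; otherwise continuity applies.\<close>

lemma gamma2_df_nonzero_nearby:
  assumes c: "c > 0" and t: "t > 1"
  obtains e where "e > 0" "\<And>x. x \<noteq> t \<Longrightarrow> \<bar>x - t\<bar> < e \<Longrightarrow> x > 1 \<and> gamma2_df c x \<noteq> 0"
proof (cases "gamma2_df c t = 0")
  case True
  show ?thesis
  proof
    show "t - 1 > 0" using t by simp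
    show "x > 1 \<and> gamma2_df c x \<noteq> 0" if "x \<noteq> t" "\<bar>x - t\<bar> < t - 1" for x
      using that gamma2_df_zero_unique[OF c _ t _ True, of x] by (auto simp: abs_less_iff)
  qed
next
  case False
  have "isCont (gamma2_df c) t"
    unfolding gamma2_df_def using c t by (intro continuous_intros) auto
  then have "\<forall>\<^sub>F x in at t. gamma2_df c x \<noteq> 0"
    using False by (intro tendsto_imp_eventually_ne[of _ "gamma2_df c t"]) (simp_all add: isCont_def)
  then obtain e where e: "e > 0" "\<And>x. x \<noteq> t \<Longrightarrow> dist x t < e \<Longrightarrow> gamma2_df c x \<noteq> 0"
    by (auto simp: eventually_at)
  show ?thesis
  proof
    show "min e (t - 1) > 0" using t e by simp
    show "x > 1 \<and> gamma2_df c x \<noteq> 0" if "x \<noteq> t" "\<bar>x - t\<bar> < min e (t - 1)" for x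
      using that e(2)[of x] by (auto simp: abs_less_iff dist_real_def)
  qed
qed

text \<open>By Cauchy's mean value theorem a secant slope is the value of h'/f' = m at an
  intermediate point, where f' is nonzero and cancels. This works even if f' vanishes at
  \<open>t\<close> itself.\<close>

lemma gamma2_secant_slope:
  assumes c: "c > 0" and t: "t > 1"
  shows "\<forall>\<^sub>F u in at t. fst (gamma2 c u) \<noteq> fst (gamma2 c t)"
    and "((\<lambda>u. (snd (gamma2 c u) - snd (gamma2 c t)) / (fst (gamma2 c u) - fst (gamma2 c t)))
      \<longlongrightarrow> gamma2_slope c t) (at t)"
proof -
  let ?f = "\<lambda>u. fst (gamma2 c u)" and ?h = "\<lambda>u. snd (gamma2 c u)"
  obtain e where e: "e > 0" "\<And>x. x \<noteq> t \<Longrightarrow> \<bar>x - t\<bar> < e \<Longrightarrow> x > 1 \<and> gamma2_df c x \<noteq> 0"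
    using gamma2_df_nonzero_nearby[OF c t] by metis
  have key: "\<exists>z. z \<noteq> t \<and> \<bar>z - t\<bar> < \<bar>u - t\<bar> \<and> ?f u \<noteq> ?f t
      \<and> (?h u - ?h t) / (?f u - ?f t) = gamma2_slope c z"
    if u: "u \<noteq> t" "\<bar>u - t\<bar> < e" for u
  proof -
    \<comment> \<open>The mean value theorems want ordered end points; exchanging \<open>u\<close>
      and \<open>t\<close> leaves the quotient unchanged.\<close>
    define a where "a = min u t"
    define b where "b = max u t"
    have ab: "a < b" "1 < a" using u e(2)[OF u] t by (auto simp: a_def b_def)
    have "\<exists>z. a < z \<and> z < b \<and> (?h b - ?h a) * gamma2_df c z = (?f b - ?f a) * (gamma2_slope c z * gamma2_df c z)"
      using ab
      by (intro GMVT'[OF ab(1)] DERIV_isCont[OF gamma2_has_real_derivative(1)[OF c]]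
          DERIV_isCont[OF gamma2_has_real_derivative(2)[OF c]] gamma2_has_real_derivative[OF c]) auto
    then obtain z where z: "a < z" "z < b"
      "(?h b - ?h a) * gamma2_df c z = (?f b - ?f a) * (gamma2_slope c z * gamma2_df c z)" by blast
    have zt: "z \<noteq> t" "\<bar>z - t\<bar> < \<bar>u - t\<bar>" using z(1,2)
      by (auto simp: a_def b_def min_def max_def abs_if split: if_splits)
    have "gamma2_df c z \<noteq> 0" using e(2)[OF zt(1)] zt u by auto
    with z(3) have eq: "?h b - ?h a = (?f b - ?f a) * gamma2_slope c z" by simp
    \<comment> \<open>The ordinary mean value theorem shows that the denominator of the secant slope
      is nonzero.\<close>
    obtain y where y: "a < y" "y < b" "?f b - ?f a = (b - a) * gamma2_df c y"
      using MVT2[OF ab(1), of ?f "gamma2_df c"] gamma2_has_real_derivative(1)[OF c] ab by auto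
    have yt: "y \<noteq> t" "\<bar>y - t\<bar> < \<bar>u - t\<bar>" using y(1,2)
      by (auto simp: a_def b_def min_def max_def abs_if split: if_splits)
    have "gamma2_df c y \<noteq> 0" using e(2)[OF yt(1)] yt u by auto
    with y(3) ab have ne: "?f b \<noteq> ?f a" by auto
    have "?f u \<noteq> ?f t" "(?h u - ?h t) / (?f u - ?f t) = gamma2_slope c z"
      using ne eq by (auto simp: a_def b_def min_def max_def divide_simps algebra_simps split: if_splits)
    with zt show ?thesis by blast
  qed
  show "\<forall>\<^sub>F u in at t. ?f u \<noteq> ?f t"
    unfolding eventually_at using e(1) key by (auto simp: dist_real_def)
  have "isCont (gamma2_slope c) t"
    unfolding gamma2_slope_def using t by (intro continuous_intros) auto
  show "((\<lambda>u. (?h u - ?h t) / (?f u - ?f t)) \<longlongrightarrow> gamma2_slope c t) (at t)"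
  proof (rule LIM_I)
    fix r :: real assume "r > 0"
    then obtain d where d: "d > 0" "\<And>z. z \<noteq> t \<Longrightarrow> \<bar>z - t\<bar> < d \<Longrightarrow> \<bar>gamma2_slope c z - gamma2_slope c t\<bar> < r"
      using LIM_D[of "gamma2_slope c" "gamma2_slope c t" t r] \<open>isCont _ t\<close> by (auto simp: isCont_def)
    show "\<exists>d>0. \<forall>u. u \<noteq> t \<and> norm (u - t) < d \<longrightarrow> norm ((?h u - ?h t) / (?f u - ?f t) - gamma2_slope c t) < r"
    proof (intro exI[of _ "min d e"] conjI allI impI)
      fix u assume u: "u \<noteq> t \<and> norm (u - t) < min d e"
      then obtain z where "z \<noteq> t" "\<bar>z - t\<bar> < \<bar>u - t\<bar>" "(?h u - ?h t) / (?f u - ?f t) = gamma2_slope c z"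
        using key[of u] by auto
      then show "norm ((?h u - ?h t) / (?f u - ?f t) - gamma2_slope c t) < r" using d(2)[of z] u by auto
    qed (use d e in auto)
  qed
qed

lemma has_tangent_direction_gamma2_iff:
  assumes c: "c > 0" and t: "t \<in> gamma2_domain c"
  shows "has_tangent_direction (gamma2 c) (gamma2_domain c) t v \<longleftrightarrow> v \<noteq> 0 \<and> snd v = gamma2_slope c t * fst v"
proof -
  have t1: "t > 1" using t by (simp add: gamma2_domain_def)
  \<comment> \<open>As \<open>t\<close> may be the right end point of the domain, it is approached
    from the left.\<close>
  have "t islimpt {1<..<t}" using t1 by (simp add: islimpt_greaterThanLessThan2)
  then have "t islimpt gamma2_domain c"
    by (rule islimpt_subset) (use t in \<open>auto simp: gamma2_domain_def\<close>)
  moreover have "\<forall>\<^sub>F u in at t within gamma2_domain c. fst (gamma2 c u) \<noteq> fst (gamma2 c t)"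
    using gamma2_secant_slope(1)[OF c t1] by (rule filter_leD[OF at_le, rotated]) simp
  moreover note tendsto_within_subset[OF gamma2_secant_slope(2)[OF c t1] subset_UNIV]
  ultimately show ?thesis by (intro has_tangent_direction_iff_slope t)
qed

definition gamma1_slope :: "real \<Rightarrow> real \<Rightarrow> real" where
  "gamma1_slope c f = - (1 / (2 - f)) - c / (2 * f)"

lemma has_tangent_direction_gamma1_iff:
  assumes t: "t \<in> gamma1_domain"
  shows "has_tangent_direction (gamma1 c) gamma1_domain t v \<longleftrightarrow> v \<noteq> 0 \<and> snd v = gamma1_slope c t * fst v"
proof -
  have t1: "t > 0" "t < 2" using t by (auto simp: gamma1_domain_def)
  have "((\<lambda>u. snd (gamma1 c u)) has_real_derivative gamma1_slope c t) (at t)"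
    unfolding gamma1_def snd_conv using t1
    by (auto intro!: derivative_eq_intros simp: gamma1_slope_def field_simps)
  then have lim: "((\<lambda>u. (snd (gamma1 c u) - snd (gamma1 c t)) / (fst (gamma1 c u) - fst (gamma1 c t)))
      \<longlongrightarrow> gamma1_slope c t) (at t within gamma1_domain)"
    by (auto simp: has_field_derivative_iff gamma1_def intro: tendsto_within_subset)
  have "t islimpt gamma1_domain"
    using t by (simp add: gamma1_domain_def islimpt_greaterThanLessThan1 interior_limit_point)
  moreover have "\<forall>\<^sub>F u in at t within gamma1_domain. fst (gamma1 c u) \<noteq> fst (gamma1 c t)"
    by (auto simp: gamma1_def eventually_at_filter)
  ultimately show ?thesis using lim by (intro has_tangent_direction_iff_slope t)
qed

section \<open>Cusp and tangency\<close>

text \<open>A closed form valid on an open set can be differentiated in place of the iterated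
  derivative; repeated use climbs one order at a time.\<close>

lemma nth_vector_derivative_Suc_eq:
  assumes "open S" "t \<in> S" and eq: "\<And>u. u \<in> S \<Longrightarrow> nth_vector_derivative n g u = G u"
    and D: "(G has_vector_derivative D) (at t)"
  shows "nth_vector_derivative (Suc n) g t = D"
    "nth_vector_derivative n g differentiable (at t)"
proof -
  have "(nth_vector_derivative n g has_vector_derivative D) (at t)"
    using has_vector_derivative_transform_within_open[OF D assms(1,2)] eq by simp
  then show "nth_vector_derivative (Suc n) g t = D"
    "nth_vector_derivative n g differentiable (at t)"
    by (auto simp: nth_vector_derivative_def vector_derivative_at has_vector_derivative_def intro: differentiableI)
qed

lemma DERIV_const_divide_power:
  fixes g :: "real \<Rightarrow> real"
  assumes "(g has_real_derivative 1) (at x)" "g x \<noteq> 0"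
  shows "((\<lambda>x. k / g x ^ Suc j) has_real_derivative - (real (Suc j) * k) / g x ^ Suc (Suc j)) (at x)"
proof -
  have "((\<lambda>x. g x ^ Suc j) has_real_derivative real (Suc j) * g x ^ j) (at x)"
    using DERIV_power[OF assms(1), of "Suc j"] by simp
  from DERIV_divide[OF DERIV_const this] show ?thesis
    by (rule DERIV_cong) (use assms(2) in \<open>simp_all add: divide_simps\<close>)
qed

section \<open>Derivatives of all orders along \<open>gamma2\<close>\<close>

lemma gamma2_has_vector_derivative:
  assumes "c > 0" "s > 1"
  shows "(gamma2 c has_vector_derivative (gamma2_df c s, gamma2_slope c s * gamma2_df c s)) (at s)"
  using gamma2_has_real_derivative[OF assms, unfolded has_real_derivative_iff_has_vector_derivative]
    has_vector_derivative_Pair by fastforce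

lemma nth_vector_derivative_1_gamma2:
  assumes c: "c > 0" and s: "s > 1"
  shows "nth_vector_derivative (Suc 0) (gamma2 c) s = (gamma2_df c s, gamma2_slope c s * gamma2_df c s)"
    and "nth_vector_derivative 0 (gamma2 c) differentiable (at s)"
  using s nth_vector_derivative_Suc_eq[of "{1<..}" s 0 "gamma2 c" "gamma2 c",
      OF _ _ _ gamma2_has_vector_derivative[OF assms]]
  by (simp_all add: nth_vector_derivative_def)

text \<open>In partial fractions every derivative of positive order is a constant plus multiples of
  powers of \<open>1/(c + s - 1)\<close>, \<open>1/(s - 1)\<close> and \<open>1/s\<close>.\<close>

lemma nth_vector_derivative_gamma2_form:
  assumes c: "c > 0"
  shows "\<exists>a b p q r. \<forall>s>1. nth_vector_derivative (Suc n) (gamma2 c) s =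
    (a + b / (c + s - 1) ^ Suc (Suc n), p / (s - 1) ^ Suc n + q / s ^ Suc n + r / (c + s - 1) ^ Suc n)"
proof (induction n)
  case 0
  show ?case
    using nth_vector_derivative_1_gamma2(1)[OF c] gamma2_dh_eq[OF c]
    by (intro exI[of _ "c - 2"] exI[of _ "- (c * (c - 1)\<^sup>2)"] exI[of _ "1/2"] exI[of _ "1 - c"] exI[of _ "(c - 1)/2"])
      (simp add: gamma2_df_def power2_eq_square)
next
  case (Suc n)
  then obtain a b p q r where IH: "\<And>s. s > 1 \<Longrightarrow> nth_vector_derivative (Suc n) (gamma2 c) s =
    (a + b / (c + s - 1) ^ Suc (Suc n), p / (s - 1) ^ Suc n + q / s ^ Suc n + r / (c + s - 1) ^ Suc n)"
    by blast
  \<comment> \<open>The leading \<open>0 +\<close> keeps the shape of the induction hypothesis, so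
    that the new coefficients can be read off.\<close>
  have D: "((\<lambda>s. (a + b / (c + s - 1) ^ Suc (Suc n), p / (s - 1) ^ Suc n + q / s ^ Suc n + r / (c + s - 1) ^ Suc n))
     has_vector_derivative
       (0 + - (real (Suc (Suc n)) * b) / (c + s - 1) ^ Suc (Suc (Suc n)),
        - (real (Suc n) * p) / (s - 1) ^ Suc (Suc n) + - (real (Suc n) * q) / s ^ Suc (Suc n)
        + - (real (Suc n) * r) / (c + s - 1) ^ Suc (Suc n))) (at s)" if "s > 1" for s
    using that c
    by (intro has_vector_derivative_Pair; unfold has_real_derivative_iff_has_vector_derivative[symmetric])
       (intro DERIV_add DERIV_const DERIV_const_divide_power; auto intro!: derivative_eq_intros)+
  have "nth_vector_derivative (Suc (Suc n)) (gamma2 c) s = 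
       (0 + - (real (Suc (Suc n)) * b) / (c + s - 1) ^ Suc (Suc (Suc n)),
        - (real (Suc n) * p) / (s - 1) ^ Suc (Suc n) + - (real (Suc n) * q) / s ^ Suc (Suc n)
        + - (real (Suc n) * r) / (c + s - 1) ^ Suc (Suc n))" if "s > 1" for s
    by (rule nth_vector_derivative_Suc_eq(1)[OF open_greaterThan _ IH D]) (use that in simp_all)
  then show ?case by blast
qed

lemma smooth_curve_on_gamma2:
  assumes c: "c > 0"
  shows "smooth_curve_on (gamma2 c) {1<..}"
  unfolding smooth_curve_on_def
proof (intro allI ballI)
  fix n and s :: real assume s: "s \<in> {1<..}"
  show "nth_vector_derivative n (gamma2 c) differentiable (at s)"
  proof (cases n)
    case 0
    then show ?thesis using nth_vector_derivative_1_gamma2(2)[OF c] s by simp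
  next
    case (Suc m)
    obtain a b p q r where eq: "\<And>s. s > 1 \<Longrightarrow> nth_vector_derivative (Suc m) (gamma2 c) s =
      (a + b / (c + s - 1) ^ Suc (Suc m), p / (s - 1) ^ Suc m + q / s ^ Suc m + r / (c + s - 1) ^ Suc m)"
      using nth_vector_derivative_gamma2_form[OF c] by metis
    have "(\<lambda>s. (a + b / (c + s - 1) ^ Suc (Suc m), p / (s - 1) ^ Suc m + q / s ^ Suc m + r / (c + s - 1) ^ Suc m))
      differentiable (at s)"
      using s c by (intro derivative_intros) auto
    then obtain D where "((\<lambda>s. (a + b / (c + s - 1) ^ Suc (Suc m), p / (s - 1) ^ Suc m + q / s ^ Suc m + r / (c + s - 1) ^ Suc m))
      has_vector_derivative D) (at s)"
      using vector_derivative_works by blast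
    then show ?thesis unfolding Suc using s eq by (intro nth_vector_derivative_Suc_eq(2)[of "{1<..}"]) auto
  qed
qed

lemma gamma2_cusp:
  assumes c: "c > 0" "c \<noteq> 1" and s: "s > 1" and zero: "gamma2_df c s = 0"
  shows "nth_vector_derivative 1 (gamma2 c) s = 0"
    and "nth_vector_derivative 2 (gamma2 c) s \<noteq> nth_vector_derivative 3 (gamma2 c) s"
    and "independent {nth_vector_derivative 2 (gamma2 c) s, nth_vector_derivative 3 (gamma2 c) s}"
proof -
  \<comment> \<open>With f' = \<open>gamma2_df c\<close> and m = \<open>gamma2_slope c\<close>,
    these are f'', f''', m' and m''.\<close>
  define F2 where "F2 = (\<lambda>s. 2 * (c * (c - 1)\<^sup>2) / (c + s - 1) ^ 3)"
  define F3 where "F3 = (\<lambda>s. - 6 * (c * (c - 1)\<^sup>2) / (c + s - 1) ^ 4)"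
  define m1 where "m1 = (\<lambda>s. c / (2 * (s - 1)\<^sup>2) - (c - 1) / (2 * s\<^sup>2))"
  define m2 where "m2 = (\<lambda>s. - (c / (s - 1) ^ 3) - (1 - c) / s ^ 3)"
  have dq: "((\<lambda>u. k / (c + u - 1) ^ Suc j) has_real_derivative - (real (Suc j) * k) / (c + u - 1) ^ Suc (Suc j)) (at u)"
    and dm: "((\<lambda>u. k / (u - 1) ^ Suc j) has_real_derivative - (real (Suc j) * k) / (u - 1) ^ Suc (Suc j)) (at u)"
    and ds: "((\<lambda>u. k / u ^ Suc j) has_real_derivative - (real (Suc j) * k) / u ^ Suc (Suc j)) (at u)"
    if "u > 1" for u k j
    using that c by (intro DERIV_const_divide_power; auto intro!: derivative_eq_intros)+
  have D1: "(gamma2_df c has_real_derivative F2 u) (at u)" if "u > 1" for u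
    using DERIV_diff[OF DERIV_const[of "c - 2"] dq[OF that, of "c * (c - 1)\<^sup>2" 1]]
    by (simp add: gamma2_df_def[abs_def] F2_def eval_nat_numeral)
  have D2: "(F2 has_real_derivative F3 u) (at u)" if "u > 1" for u
    using dq[OF that, of "2 * (c * (c - 1)\<^sup>2)" 2] by (simp add: F2_def F3_def eval_nat_numeral)
  have E1: "(gamma2_slope c has_real_derivative m1 u) (at u)" if "u > 1" for u
    using DERIV_diff[OF ds[OF that, of "(c - 1) / 2" 0] dm[OF that, of "c / 2" 0]]
    by (simp add: gamma2_slope_def[abs_def] m1_def power2_eq_square)
  have E2: "(m1 has_real_derivative m2 u) (at u)" if "u > 1" for u
    using DERIV_diff[OF dm[OF that, of "c / 2" 1] ds[OF that, of "(c - 1) / 2" 1]]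
    by (simp add: m1_def m2_def eval_nat_numeral diff_divide_distrib)
  let ?F = "gamma2_df c" and ?m = "gamma2_slope c"
  have n1: "nth_vector_derivative (Suc 0) (gamma2 c) u = (?F u, ?m u * ?F u)" if "u > 1" for u
    using nth_vector_derivative_1_gamma2[OF c(1) that] by simp
  have n2: "nth_vector_derivative (Suc (Suc 0)) (gamma2 c) u = (F2 u, m1 u * ?F u + ?m u * F2 u)" if u: "u > 1" for u
  proof (rule nth_vector_derivative_Suc_eq(1)[of "{1<..}", OF _ _ n1])
    show "((\<lambda>u. (?F u, ?m u * ?F u)) has_vector_derivative (F2 u, m1 u * ?F u + ?m u * F2 u)) (at u)"
      using DERIV_mult[OF E1[OF u] D1[OF u]] D1[OF u]
      unfolding has_real_derivative_iff_has_vector_derivative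
      by (intro has_vector_derivative_Pair) (simp_all add: algebra_simps)
  qed (use u in auto)
  have n3: "nth_vector_derivative (Suc (Suc (Suc 0))) (gamma2 c) u =
      (F3 u, (m2 u * ?F u + m1 u * F2 u) + (m1 u * F2 u + ?m u * F3 u))" if u: "u > 1" for u
  proof (rule nth_vector_derivative_Suc_eq(1)[of "{1<..}", OF _ _ n2])
    show "((\<lambda>u. (F2 u, m1 u * ?F u + ?m u * F2 u)) has_vector_derivative
        (F3 u, (m2 u * ?F u + m1 u * F2 u) + (m1 u * F2 u + ?m u * F3 u))) (at u)"
      using DERIV_add[OF DERIV_mult[OF E2[OF u] D1[OF u]] DERIV_mult[OF E1[OF u] D2[OF u]]] D2[OF u]
      unfolding has_real_derivative_iff_has_vector_derivative
      by (intro has_vector_derivative_Pair) (simp_all add: algebra_simps)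
  qed (use u in auto)
  show "nth_vector_derivative 1 (gamma2 c) s = 0"
    using n1[OF s] zero by (simp add: zero_prod_def)
  let ?v = "(F2 s, ?m s * F2 s)" and ?w = "(F3 s, 2 * m1 s * F2 s + ?m s * F3 s)"
  have v: "nth_vector_derivative 2 (gamma2 c) s = ?v" and w: "nth_vector_derivative 3 (gamma2 c) s = ?w"
    using n2[OF s] n3[OF s] zero by (simp_all add: eval_nat_numeral)
  have F2: "F2 s \<noteq> 0" using c s by (simp add: F2_def)
  have m1: "m1 s \<noteq> 0"
  proof -
    \<comment> \<open>The numerator c s^2 - (c - 1) (s - 1)^2 is regrouped into a sum of positive
      terms.\<close>
    have "m1 s = ((s - 1)\<^sup>2 + c * (2 * s - 1)) / (2 * s\<^sup>2 * (s - 1)\<^sup>2)"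
      using s by (simp add: m1_def divide_simps) (simp add: power2_eq_square algebra_simps)
    moreover have "(s - 1)\<^sup>2 + c * (2 * s - 1) > 0" using s c by (intro add_pos_pos) auto
    ultimately show ?thesis using s by simp
  qed
  have "?w \<notin> span {?v}"
  proof
    assume "?w \<in> span {?v}"
    then obtain k where "?w = k *\<^sub>R ?v" unfolding span_singleton by (rule rangeE)
    then have k: "F3 s = k * F2 s \<and> 2 * m1 s * F2 s + ?m s * F3 s = k * (?m s * F2 s)"
      unfolding scaleR_Pair prod.inject real_scaleR_def .
    \<comment> \<open>First coordinates give f''' = k f''; the second ones then leave 2 m' f'' =
      0.\<close>
    have "m1 s * F2 s = 0"
      using conjunct2[OF k] unfolding conjunct1[OF k] by (simp add: algebra_simps)
    then show False using m1 F2 by simp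
  qed
  moreover have "?v \<noteq> 0" using F2 by (simp add: zero_prod_def)
  ultimately have "independent {?w, ?v}" "?v \<noteq> ?w"
    by (auto simp: independent_insert span_base)
  then show "nth_vector_derivative 2 (gamma2 c) s \<noteq> nth_vector_derivative 3 (gamma2 c) s"
    "independent {nth_vector_derivative 2 (gamma2 c) s, nth_vector_derivative 3 (gamma2 c) s}"
    unfolding v w by (simp_all add: insert_commute)
qed

text \<open>Up to a positive factor f' is (c - 2) p (p + 2 c) - c with p = s - 1, increasing in p >
  0. It vanishes at the cusp parameter and is positive at the tangency parameter, which orders the
  two.\<close>

lemma s_cusp_props:
  assumes c: "c > 3"
  shows "gamma2_df c (s_cusp c) = 0" "1 < s_cusp c" "s_cusp c < s_tangency c"
proof -
  define p where "p = s_cusp c - 1"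
  define w where "w = sqrt (c * (c - 2))"
  have w: "w\<^sup>2 = c * (c - 2)" using c by (simp add: w_def)
  have p_eq: "p + c = (c - 1) * w / (c - 2)"
    using c by (simp add: p_def s_cusp_def w_def divide_simps) (simp add: algebra_simps)
  have "(c - 2) * (p + c)\<^sup>2 = (c - 1)\<^sup>2 * w\<^sup>2 / (c - 2)"
    unfolding p_eq using c by (simp add: power_mult_distrib power_divide power2_eq_square)
  also have "\<dots> = c * (c - 1)\<^sup>2" using c by (simp add: w)
  finally have sq: "(c - 2) * (p + c)\<^sup>2 = c * (c - 1)\<^sup>2" .
  \<comment> \<open>The square is expanded and c^2 (c - 2) subtracted from both sides.\<close>
  then have N: "(c - 2) * p * (p + 2 * c) = c" by (simp add: power2_eq_square algebra_simps)
  have "w > 0" using c by (simp add: w_def)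
  then have pc: "p + c > 0" unfolding p_eq using c by simp
  then have "p + 2 * c > 0" using c by simp
  have p0: "p > 0"
  proof (rule ccontr)
    assume "\<not> p > 0"
    then have "(c - 2) * p \<le> 0" using c by (simp add: mult_le_0_iff)
    then have "(c - 2) * p * (p + 2 * c) \<le> 0" using \<open>p + 2 * c > 0\<close> by (simp add: mult_le_0_iff)
    then show False using N c by simp
  qed
  then show s1: "1 < s_cusp c" by (simp add: p_def)
  show "gamma2_df c (s_cusp c) = 0"
    using N gamma2_df_eq[OF _ s1, of c] c by (simp flip: p_def)
  define k where "k = sqrt c"
  have k: "k\<^sup>2 = c" "k > 0" using c by (auto simp: k_def)
  define t where "t = k / (2 + k)"
  have t: "s_tangency c = 1 + t" "t > 0" using k by (simp_all add: s_tangency_def t_def flip: k_def) (simp add: field_simps)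
  \<comment> \<open>Multiplication by (2 + k)^2 clears the denominators of \<open>t\<close>. The
    factor c - 3 decides on which side of the zero of f' the end point lies.\<close>
  have "((c - 2) * t * (t + 2 * c) - c) * (2 + k)\<^sup>2 = 2 * c * (c - 3) * (k + 1)\<^sup>2"
  proof -
    have "t * (2 + k) = k" using k by (simp add: t_def)
    moreover have "((c - 2) * t * (t + 2 * c) - c) * (2 + k)\<^sup>2 
      = (c - 2) * (t * (2 + k)) * (t * (2 + k) + 2 * c * (2 + k)) - c * (2 + k)\<^sup>2"
      by (simp add: power2_eq_square algebra_simps)
    ultimately have "((c - 2) * t * (t + 2 * c) - c) * (2 + k)\<^sup>2
      = (c - 2) * k * (k + 2 * c * (2 + k)) - c * (2 + k)\<^sup>2" by simp
    also have "\<dots> = 2 * c * (c - 3) * (k + 1)\<^sup>2"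
      unfolding k(1)[symmetric] by (simp add: power2_eq_square algebra_simps)
    finally show ?thesis .
  qed
  moreover have "2 * c * (c - 3) * (k + 1)\<^sup>2 > 0" using c k by simp
  ultimately have "((c - 2) * t * (t + 2 * c) - c) * (2 + k)\<^sup>2 > 0" by (simp only:)
  then have "(c - 2) * t * (t + 2 * c) - c > 0" by (rule zero_less_mult_pos2) (use k in simp)
  then have "(c - 2) * (p * (p + 2 * c)) < (c - 2) * (t * (t + 2 * c))" using N by (simp add: mult.assoc)
  then have lt: "p * (p + 2 * c) < t * (t + 2 * c)" using c by (simp add: mult_less_cancel_left)
  have "p < t"
  proof (rule ccontr)
    assume "\<not> p < t"
    then have "t * (t + 2 * c) \<le> p * (p + 2 * c)" using t c by (intro mult_mono) auto
    with lt show False by simp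
  qed
  then show "s_cusp c < s_tangency c" using t by (simp add: p_def)
qed

lemma has_cusp_at_s_cusp:
  assumes c: "c > 3"
  shows "has_cusp_at (gamma2 c) (gamma2_domain c) (s_cusp c)"
proof -
  have int: "interior (gamma2_domain c) = {1<..<s_tangency c}"
    by (simp add: gamma2_domain_def)
  have "smooth_curve_on (gamma2 c) {1<..<s_tangency c}"
    using smooth_curve_on_gamma2[of c] c by (auto simp: smooth_curve_on_def)
  then show ?thesis
    using gamma2_cusp[of c "s_cusp c"] s_cusp_props[OF c] c by (simp add: has_cusp_at_def int)
qed

section \<open>Coincidence at c = 3 and tangency of the two curves\<close>

lemma s_cusp_eq_s_tangency: "s_cusp 3 = s_tangency 3"
proof -
  have "sqrt 3 * sqrt 3 = (3::real)" by simp
  moreover have "2 + sqrt (3::real) > 0" by (simp add: add_pos_pos)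
  ultimately show ?thesis
    by (simp add: s_cusp_def s_tangency_def eq_divide_eq) (simp add: algebra_simps)
qed

text \<open>Over a common denominator the difference of the slopes is c (1 - p)^2 - 4 p^2 times a
  positive factor.\<close>

lemma gamma1_slope_eq_gamma2_slope_iff:
  assumes c: "c > 0" and p: "0 < p" "p < 1"
    and f: "f * (c + p) = c * (1 + p\<^sup>2) - 2 * p\<^sup>2" "0 < f" "f < 2"
  shows "gamma1_slope c f = gamma2_slope c (1 + p) \<longleftrightarrow> 4 * p\<^sup>2 = c * (1 - p)\<^sup>2"
proof -
  \<comment> \<open>These come from f = u / (c + p) and 2 - f = (1 + p) w / (c + p); 0 < f < 2 makes
    both positive.\<close>
  define u where "u = c + (c - 2) * p\<^sup>2"
  define w where "w = c - (c - 2) * p"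
  have q: "c + p > 0" using c p by simp
  have e: "f * (c + p) = u" "(2 - f) * (c + p) = (1 + p) * w"
    using f by (simp_all add: u_def w_def power2_eq_square algebra_simps)
  have "f * (c + p) > 0" "(2 - f) * (c + p) > 0" using f(2,3) q by (intro mult_pos_pos; simp)+
  then have pos: "u > 0" "w > 0" unfolding e using p by (simp_all add: zero_less_mult_iff)
  have fu: "f = u / (c + p)" "2 - f = (1 + p) * w / (c + p)"
    using e q by (simp_all add: eq_divide_eq)
  have "gamma2_slope c (1 + p) = - ((c + p) / (2 * p * (1 + p)))"
    using p by (simp add: gamma2_slope_def divide_simps) (simp add: algebra_simps)
  then have "gamma1_slope c f - gamma2_slope c (1 + p)
     = (c + p) / (2 * p * (1 + p)) - (c + p) / ((1 + p) * w) - c * (c + p) / (2 * u)"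
    unfolding gamma1_slope_def fu(2) by (simp add: fu(1))
  also have "\<dots> = (c + p) * (w * u - 2 * p * u - c * p * (1 + p) * w) / (2 * p * (1 + p) * w * u)"
    using p pos by (simp add: divide_simps) (simp add: algebra_simps)
  also have "w * u - 2 * p * u - c * p * (1 + p) * w = c * (c * (1 - p)\<^sup>2 - 4 * p\<^sup>2)"
    by (simp add: w_def u_def power2_eq_square algebra_simps)
  finally have "gamma1_slope c f = gamma2_slope c (1 + p) \<longleftrightarrow>
      (c + p) * (c * (c * (1 - p)\<^sup>2 - 4 * p\<^sup>2)) / (2 * p * (1 + p) * w * u) = 0" by linarith
  then show ?thesis using p pos q c by auto
qed

text \<open>Neither curve has a vertical tangent, so a common direction means equal slopes, which
  occurs exactly where f = 2 p, that is r1 = r2.\<close>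

lemma tangent_iff:
  assumes c: "c > 0" and s: "s \<in> gamma2_domain c"
  shows "(\<exists>f\<in>gamma1_domain. tangent_curves_at (gamma1 c) gamma1_domain f (gamma2 c) (gamma2_domain c) s)
    \<longleftrightarrow> s = s_tangency c"
proof -
  define p where "p = s - 1"
  have sp: "s = 1 + p" by (simp add: p_def)
  have p: "0 < p" "p < 1" using s s_tangency_less_2[OF c] by (auto simp: p_def gamma2_domain_def)
  define f0 where "f0 = (c * (1 + p\<^sup>2) - 2 * p\<^sup>2) / (c + p)"
  have f0: "f0 * (c + p) = c * (1 + p\<^sup>2) - 2 * p\<^sup>2" using c p by (simp add: f0_def)
  note g2 = gamma2_eqI[OF c p(1) f0, folded sp]
  note end_iff = le_s_tangency_iff(2)[OF c p, folded sp]
  show ?thesis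
  proof
    assume "\<exists>f\<in>gamma1_domain. tangent_curves_at (gamma1 c) gamma1_domain f (gamma2 c) (gamma2_domain c) s"
    then obtain f v where f: "f \<in> gamma1_domain" "gamma1 c f = gamma2 c s"
      and v: "has_tangent_direction (gamma1 c) gamma1_domain f v"
        "has_tangent_direction (gamma2 c) (gamma2_domain c) s v"
      unfolding tangent_curves_at_def by blast
    \<comment> \<open>The first coordinate of \<open>gamma1\<close> is its parameter, so the common
      point fixes \<open>f\<close>.\<close>
    have ff: "f = f0" using f(2) by (simp add: g2 gamma1_def)
    have "v \<noteq> 0" "snd v = gamma1_slope c f * fst v" "snd v = gamma2_slope c s * fst v"
      using v has_tangent_direction_gamma1_iff[OF f(1)] has_tangent_direction_gamma2_iff[OF c s] by auto
    then have "gamma1_slope c f = gamma2_slope c s" by (auto simp: prod_eq_iff)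
    then show "s = s_tangency c"
      using gamma1_slope_eq_gamma2_slope_iff[OF c p f0] f(1) ff end_iff by (simp add: gamma1_domain_def flip: sp)
  next
    assume "s = s_tangency c"
    then have end_eq: "4 * p\<^sup>2 = c * (1 - p)\<^sup>2" using end_iff by simp
    have "2 * p * (c + p) = f0 * (c + p)"
      unfolding f0 using end_eq by (simp add: power2_eq_square algebra_simps)
    then have f2p: "f0 = 2 * p" using c p by simp
    then have dom: "f0 \<in> gamma1_domain" using p by (simp add: gamma1_domain_def)
    \<comment> \<open>With f = 2 p this is a perfect square and f + 2 p = 2 f, so the logarithms
      become those of \<open>gamma1\<close>.\<close>
    have "1 - f0 + p\<^sup>2 = (1 - p)\<^sup>2" by (simp add: f2p power2_eq_square algebra_simps)
    then have eq: "gamma1 c f0 = gamma2 c s"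
      using p by (simp add: g2 gamma1_def ln_realpow) (simp add: f2p)
    have "gamma1_slope c f0 = gamma2_slope c s"
      using gamma1_slope_eq_gamma2_slope_iff[OF c p f0] dom end_eq by (simp add: gamma1_domain_def flip: sp)
    then have "has_tangent_direction (gamma1 c) gamma1_domain f0 (1, gamma2_slope c s)"
      "has_tangent_direction (gamma2 c) (gamma2_domain c) s (1, gamma2_slope c s)"
      by (simp_all add: has_tangent_direction_gamma1_iff[OF dom] has_tangent_direction_gamma2_iff[OF c s] zero_prod_def)
    with eq dom show "\<exists>f\<in>gamma1_domain. tangent_curves_at (gamma1 c) gamma1_domain f (gamma2 c) (gamma2_domain c) s"
      unfolding tangent_curves_at_def by blast
  qed
qed

theorem mainTheorem2:
  fixes c :: real
  assumes "c > 0"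
  shows "bifurcation_diagram c = gamma1 c ` gamma1_domain \<union> gamma2 c ` gamma2_domain c
    \<and> (c > 3 \<longrightarrow> has_cusp_at (gamma2 c) (gamma2_domain c) (s_cusp c))
    \<and> (c = 3 \<longrightarrow> s_cusp c = s_tangency c)
    \<and> (\<forall>s\<in>gamma2_domain c.
         (\<exists>f\<in>gamma1_domain.
            tangent_curves_at (gamma1 c) gamma1_domain f (gamma2 c) (gamma2_domain c) s)
         \<longleftrightarrow> s = s_tangency c)"
  using bifurcation_diagram_eq[OF assms] has_cusp_at_s_cusp s_cusp_eq_s_tangency tangent_iff[OF assms]
  by blast

end
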